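(* Let $T$ be a finite tree and let $xy\in E(T)$ be an internal edge, i.e. $d_x\ge 2$ and $d_y\ge 2$. Let $T^{(2)}$ be the tree obtained from $T$ by inserting one new vertex of degree $2$ into the edge $xy$. Put $\lambda_1=\lambda_{\max}(R_T)$ and $\lambda_2=\lambda_{\max}(R_{T^{(2)}})$. Let $\mathbf w>0$ be the Perron vector of $R_T$, $w:=\mathbf w_{xy}$, $S_z:=\sum_{f\ni z}\mathbf w_f$ for each vertex $z$ of $T$, and $$u:=\frac{S_y-2w}{d_y w},\qquad v:=\frac{S_x-2w}{d_x w}.$$ Then $$\lambda_2<\lambda_1\iff uv>-\tfrac{\lambda_1}{2},\qquad \lambda_2=\lambda_1\iff uv=-\tfrac{\lambda_1}{2},\qquad \lambda_2>\lambda_1\iff uv<-\tfrac{\lambda_1}{2}.$$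
   Context: For a finite tree $T=(V,E)$ let $d_z$ denote the degree of the vertex $z$. The Ricci matrix $R_T\in\mathbb R^{E\times E}$ is the real symmetric matrix indexed by edges with entries $(R_T)_{e,e}=-\left(\frac1{d_x}+\frac1{d_y}\right)$ for $e=\{x,y\}$, $(R_T)_{e,e'}=\frac1{d_z}$ if $e\ne e'$ and $e\cap e'=\{z\}$, and $(R_T)_{e,e'}=0$ if $e\cap e'=\varnothing$. $\lambda_{\max}(M)$ denotes the largest eigenvalue of a real symmetric matrix $M$. The Perron vector of $R_T$ is the entrywise strictly positive eigenvector (unique up to positive scaling) for the simple eigenvalue $\lambda_{\max}(R_T)$; the quantities $u,v$ do not depend on the scaling. In $T^{(2)}$ the edge $xy$ is replaced by two edges $xv_1$ and $v_1y$, where $v_1$ is a new vertex of degree $2$; everything else is unchanged. The matrix $R_{T^{(2)}}$ is computed with the degrees of $T^{(2)}$. *)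

theory Defs
  imports Complex_Main
begin

text \<open>
  A finite undirected simple graph is given by its vertex set \<open>V\<close> and its set \<open>E\<close> of edges,
  an edge being a two-element set of vertices. (The notion of tree in \<open>Graph_Theory\<close> forbids
  directed cycles, hence excludes symmetric digraphs, so it does not apply to undirected trees.)
\<close>

definition finite_simple_graph :: "'a set \<Rightarrow> 'a set set \<Rightarrow> bool" where
  "finite_simple_graph V E \<longleftrightarrow>
     finite V \<and> (\<forall>e\<in>E. \<exists>x\<in>V. \<exists>y\<in>V. x \<noteq> y \<and> e = {x, y})"

definition connected_graph :: "'a set \<Rightarrow> 'a set set \<Rightarrow> bool" where
  "connected_graph V E \<longleftrightarrow>
     V \<noteq> {} \<and> (\<forall>x\<in>V. \<forall>y\<in>V. (x, y) \<in> {(a, b). {a, b} \<in> E}\<^sup>*)"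

definition is_cycle :: "'a set set \<Rightarrow> 'a list \<Rightarrow> bool" where
  "is_cycle E p \<longleftrightarrow>
     3 \<le> length p \<and> distinct p \<and>
     (\<forall>i<length p. {p ! i, p ! (Suc i mod length p)} \<in> E)"

definition finite_tree :: "'a set \<Rightarrow> 'a set set \<Rightarrow> bool" where
  "finite_tree V E \<longleftrightarrow>
     finite_simple_graph V E \<and> connected_graph V E \<and> (\<nexists>p. is_cycle E p)"

definition degree :: "'a set set \<Rightarrow> 'a \<Rightarrow> nat" where
  "degree E z = card {e \<in> E. z \<in> e}"

definition subdivide_edge :: "'a set set \<Rightarrow> 'a \<Rightarrow> 'a \<Rightarrow> 'a \<Rightarrow> 'a set set" where
  "subdivide_edge E x y z = (E - {{x, y}}) \<union> {{x, z}, {z, y}}"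

text \<open>
  Matrices indexed by a finite set \<open>I\<close> are functions \<open>M :: 'i \<Rightarrow> 'i \<Rightarrow> real\<close>, and vectors are functions
  \<open>w :: 'i \<Rightarrow> real\<close>; only their values on \<open>I\<close> matter.
\<close>

definition is_eigenvector ::
  "'i set \<Rightarrow> ('i \<Rightarrow> 'i \<Rightarrow> real) \<Rightarrow> ('i \<Rightarrow> real) \<Rightarrow> real \<Rightarrow> bool" where
  "is_eigenvector I M w l \<longleftrightarrow>
     (\<exists>i\<in>I. w i \<noteq> 0) \<and> (\<forall>i\<in>I. (\<Sum>j\<in>I. M i j * w j) = l * w i)"

text \<open>
  Meant for symmetric \<open>M\<close> and finite nonempty \<open>I\<close>: then all eigenvalues are real and
  the set below is finite and nonempty.
\<close>

definition lambda_max :: "'i set \<Rightarrow> ('i \<Rightarrow> 'i \<Rightarrow> real) \<Rightarrow> real" where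
  "lambda_max I M = Max {l. \<exists>w. is_eigenvector I M w l}"

text \<open>
  Distinct edges of a simple graph meet in at most one vertex, so the off-diagonal sum has at
  most one term: it is \<open>1 / d\<^sub>z\<close> if \<open>e \<inter> f = {z}\<close>, and \<open>0\<close> if \<open>e\<close> and \<open>f\<close> are disjoint.
\<close>

definition ricci_matrix :: "'a set set \<Rightarrow> 'a set \<Rightarrow> 'a set \<Rightarrow> real" where
  "ricci_matrix E e f =
     (if e = f then - (\<Sum>z\<in>e. 1 / real (degree E z))
      else (\<Sum>z\<in>e \<inter> f. 1 / real (degree E z)))"

definition is_perron_vector :: "'a set set \<Rightarrow> ('a set \<Rightarrow> real) \<Rightarrow> bool" where
  "is_perron_vector E w \<longleftrightarrow>
     (\<forall>e\<in>E. 0 < w e) \<and>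
     is_eigenvector E (ricci_matrix E) w (lambda_max E (ricci_matrix E))"

definition vertex_sum :: "'a set set \<Rightarrow> ('a set \<Rightarrow> real) \<Rightarrow> 'a \<Rightarrow> real" where
  "vertex_sum E w z = (\<Sum>f\<in>{f \<in> E. z \<in> f}. w f)"

end

theory Submission
  imports "HOL-Analysis.Function_Topology" Defs
begin

text \<open>
  The eigenvalue equation of \<open>R\<^sub>T\<close> at the edge \<open>xy\<close> reads \<open>\<lambda>\<^sub>1 = u + v\<close>. Removing \<open>xy\<close> splits the tree,
  so on \<open>T\<^sup>(\<^sup>2\<^sup>)\<close> one can take the Perron vector of \<open>T\<close> on the side of \<open>x\<close> and \<open>A\<close> times it on the
  side of \<open>y\<close>, with the values \<open>w\<close> and \<open>A w\<close> on the two new edges. For \<open>A = 2 u + 1\<close>, which is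
  positive as \<open>d\<^sub>y \<ge> 2\<close>, this vector \<open>z > 0\<close> satisfies \<open>R z = \<lambda>\<^sub>1 z\<close> at all edges but the new edge
  at \<open>y\<close>, where \<open>R z = \<lambda>\<^sub>1 z - (2 u v + \<lambda>\<^sub>1) w\<close>. The sign of \<open>2 u v + \<lambda>\<^sub>1\<close> thus decides whether \<open>z\<close> is a
  strict subsolution or supersolution or an eigenvector: a maximum principle bounds \<open>\<lambda>\<^sub>2\<close> from
  above, and the Rayleigh quotient of \<open>z\<close> bounds it from below.
\<close>

section \<open>Eigenvalues of real symmetric matrices\<close>

text \<open>Symmetry moves \<open>M\<close> from one factor of the pairing to the other, so
  \<open>k\<close> and \<open>l\<close> multiply the same number.\<close>

lemma eigenvectors_orthogonal:
  assumes sym: "\<And>i j. i \<in> I \<Longrightarrow> j \<in> I \<Longrightarrow> M i j = M j i"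
    and p: "is_eigenvector I M p k" and q: "is_eigenvector I M q l" and "k \<noteq> l"
  shows "(\<Sum>i\<in>I. p i * q i) = 0"
proof -
  have "k * (\<Sum>i\<in>I. p i * q i) = (\<Sum>i\<in>I. (\<Sum>j\<in>I. M i j * p j) * q i)"
    using p by (simp add: is_eigenvector_def sum_distrib_left mult.assoc)
  also have "\<dots> = (\<Sum>i\<in>I. \<Sum>j\<in>I. M i j * p j * q i)"
    by (simp add: sum_distrib_right)
  also have "\<dots> = (\<Sum>j\<in>I. \<Sum>i\<in>I. M i j * p j * q i)"
    by (rule sum.swap)
  also have "\<dots> = (\<Sum>j\<in>I. p j * (\<Sum>i\<in>I. M j i * q i))"
    by (auto simp: sum_distrib_left sym intro!: sum.cong)
  also have "\<dots> = l * (\<Sum>i\<in>I. p i * q i)"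
    using q by (simp add: is_eigenvector_def sum_distrib_left algebra_simps)
  finally show ?thesis using \<open>k \<noteq> l\<close> by simp
qed

text \<open>Bessel's inequality for the unit vectors, summed over all of them.\<close>

lemma card_orthonormal_le:
  fixes p :: "'k \<Rightarrow> 'i \<Rightarrow> real"
  assumes "finite I" "finite F"
    and orth: "\<And>k l. k \<in> F \<Longrightarrow> l \<in> F \<Longrightarrow> (\<Sum>i\<in>I. p k i * p l i) = (if k = l then 1 else 0)"
  shows "card F \<le> card I"
proof -
  have bessel: "(\<Sum>k\<in>F. (p k i)\<^sup>2) \<le> 1" if i: "i \<in> I" for i
  proof -
    \<comment> \<open>\<open>g\<close> is the orthogonal projection of the unit vector at
      \<open>i\<close> onto the span of the \<open>p k\<close>. Its squared norm is
      \<open>g i\<close>, so its squared distance to the unit vector is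
      \<open>1 - g i\<close>.\<close>
    define g where "g j = (\<Sum>k\<in>F. p k i * p k j)" for j
    have "(\<Sum>j\<in>I. (g j)\<^sup>2) = (\<Sum>j\<in>I. \<Sum>k\<in>F. \<Sum>l\<in>F. (p k i * p l i) * (p k j * p l j))"
      by (simp add: g_def power2_eq_square sum_product algebra_simps)
    also have "\<dots> = (\<Sum>k\<in>F. \<Sum>l\<in>F. \<Sum>j\<in>I. (p k i * p l i) * (p k j * p l j))"
      by (subst sum.swap, rule sum.cong, simp, subst sum.swap, simp)
    also have "\<dots> = (\<Sum>k\<in>F. \<Sum>l\<in>F. (p k i * p l i) * (if k = l then 1 else 0))"
      by (simp add: sum_distrib_left[symmetric] orth)
    also have "\<dots> = g i"
      using \<open>finite F\<close> by (simp add: g_def if_distrib cong: if_cong)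
    finally have gg: "(\<Sum>j\<in>I. (g j)\<^sup>2) = g i" .
    have "0 \<le> (\<Sum>j\<in>I. ((if j = i then 1 else 0) - g j)\<^sup>2)"
      by (simp add: sum_nonneg)
    also have "\<dots> = (\<Sum>j\<in>I. (if j = i then 1 - 2 * g j else 0) + (g j)\<^sup>2)"
      by (rule sum.cong) (auto simp: power2_diff)
    also have "\<dots> = 1 - g i"
      using \<open>finite I\<close> i by (simp add: sum.distrib gg)
    finally show ?thesis by (simp add: g_def power2_eq_square)
  qed
  have "real (card F) = (\<Sum>k\<in>F. \<Sum>i\<in>I. (p k i)\<^sup>2)"
    using orth by (simp add: power2_eq_square)
  also have "\<dots> = (\<Sum>i\<in>I. \<Sum>k\<in>F. (p k i)\<^sup>2)"
    by (rule sum.swap)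
  also have "\<dots> \<le> (\<Sum>i\<in>I. 1)"
    by (intro sum_mono bessel)
  finally show ?thesis by simp
qed

text \<open>Needed because \<open>lambda_max\<close> is a \<open>Max\<close>, which is meaningful
  only on a finite set. Normalised eigenvectors for more than \<open>card I\<close> eigenvalues
  would form too large an orthonormal system.\<close>

lemma finite_eigenvalues:
  fixes M :: "'i \<Rightarrow> 'i \<Rightarrow> real"
  assumes "finite I" and sym: "\<And>i j. i \<in> I \<Longrightarrow> j \<in> I \<Longrightarrow> M i j = M j i"
  shows "finite {l. \<exists>w. is_eigenvector I M w l}"
proof (rule ccontr)
  let ?S = "{l. \<exists>w. is_eigenvector I M w l}"
  assume "infinite ?S"
  then obtain F where F: "F \<subseteq> ?S" "finite F" "card F = Suc (card I)"
    by (meson infinite_arbitrarily_large)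
  have "\<forall>l\<in>F. \<exists>w. is_eigenvector I M w l" using F(1) by blast
  then obtain w where w: "\<And>l. l \<in> F \<Longrightarrow> is_eigenvector I M (w l) l" by metis
  define n where "n l = sqrt (\<Sum>i\<in>I. (w l i)\<^sup>2)" for l
  have n0: "n l > 0" if l: "l \<in> F" for l
  proof -
    obtain i where "i \<in> I" "w l i \<noteq> 0"
      using w[OF l] by (auto simp: is_eigenvector_def)
    then have "0 < (\<Sum>i\<in>I. (w l i)\<^sup>2)"
      using \<open>finite I\<close> by (intro sum_pos2[of I i]) auto
    then show ?thesis by (simp add: n_def)
  qed
  have nn: "n l * n l = (\<Sum>i\<in>I. (w l i)\<^sup>2)" for l
    by (simp add: n_def sum_nonneg)
  have "card F \<le> card I"
  proof (rule card_orthonormal_le[OF \<open>finite I\<close> \<open>finite F\<close>, of "\<lambda>l i. w l i / n l"])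
    fix k l assume kl: "k \<in> F" "l \<in> F"
    have eq: "(\<Sum>i\<in>I. w k i / n k * (w l i / n l)) = (\<Sum>i\<in>I. w k i * w l i) / (n k * n l)"
      by (simp add: sum_divide_distrib)
    show "(\<Sum>i\<in>I. w k i / n k * (w l i / n l)) = (if k = l then 1 else 0)"
    proof (cases "k = l")
      case True
      then show ?thesis using n0[of l] kl
        unfolding eq by (simp add: nn) (simp add: nn[symmetric] power2_eq_square[symmetric])
    next
      case False
      have "(\<Sum>i\<in>I. w k i * w l i) = 0"
        by (rule eigenvectors_orthogonal[OF _ w[OF kl(1)] w[OF kl(2)] False]) (use sym in auto)
      then show ?thesis using False unfolding eq by simp
    qed
  qed
  then show False using F(3) by simp
qed

section \<open>Rayleigh quotients and the largest eigenvalue\<close>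

lemma ex_max_on_sphere:
  fixes Q :: "('i \<Rightarrow> real) \<Rightarrow> real"
  assumes "finite I" "I \<noteq> {}" and Q: "continuous_on UNIV Q"
  shows "\<exists>p. (\<Sum>i\<in>I. (p i)\<^sup>2) = 1 \<and>
    (\<forall>q. (\<Sum>i\<in>I. (q i)\<^sup>2) = 1 \<longrightarrow> (\<forall>i. i \<notin> I \<longrightarrow> q i = 0) \<longrightarrow> Q q \<le> Q p)"
proof -
  \<comment> \<open>Vectors are functions on a whole, possibly infinite, type. Pinning the
    coordinates outside \<open>I\<close> to 0 makes the cube compact by Tychonoff, and the sphere in
    it is a closed subset.\<close>
  define B where "B = PiE UNIV (\<lambda>i. if i \<in> I then {-1..1::real} else {0})"
  define K where "K = B \<inter> {p. (\<Sum>i\<in>I. (p i)\<^sup>2) = 1}"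
  have "compactin (product_topology (\<lambda>i. euclidean) UNIV) B"
    unfolding B_def by (subst compactin_PiE) auto
  then have "compact B"
    by (simp add: euclidean_product_topology)
  moreover have "closed {p :: 'i \<Rightarrow> real. (\<Sum>i\<in>I. (p i)\<^sup>2) = 1}"
    by (intro closed_Collect_eq continuous_intros continuous_on_product_coordinates)
  ultimately have "compact K" unfolding K_def by (rule compact_Int_closed)
  obtain i0 where i0: "i0 \<in> I" using \<open>I \<noteq> {}\<close> by blast
  have "(\<lambda>i. if i = i0 then 1 else 0) \<in> K"
    using i0 \<open>finite I\<close>
    by (auto simp: K_def B_def power2_eq_square if_distrib[of "\<lambda>t. t * _"] cong: if_cong)
  then have "K \<noteq> {}" by blast
  have inK: "q \<in> K" if q: "(\<Sum>i\<in>I. (q i)\<^sup>2) = 1" "\<forall>i. i \<notin> I \<longrightarrow> q i = 0" for q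
  proof -
    have "\<bar>q i\<bar> \<le> 1" if "i \<in> I" for i
    proof -
      have "(q i)\<^sup>2 \<le> (\<Sum>i\<in>I. (q i)\<^sup>2)"
        using that \<open>finite I\<close> by (intro member_le_sum) auto
      then show ?thesis using q by (simp add: abs_square_le_1)
    qed
    then show ?thesis using q by (auto simp: K_def B_def abs_le_iff)
  qed
  obtain p where "p \<in> K" "\<forall>q\<in>K. Q q \<le> Q p"
    using continuous_attains_sup[OF \<open>compact K\<close> \<open>K \<noteq> {}\<close>] continuous_on_subset[OF Q] by blast
  then show ?thesis using inK by (auto simp: K_def)
qed

text \<open>A first-order condition without derivatives: the polynomial vanishes at
  \<open>t = 0\<close>, which is then a minimum.\<close>

lemma linear_coeff_zero:
  fixes b c :: real
  assumes "\<And>t. 0 \<le> 2 * t * b + t\<^sup>2 * c"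
  shows "b = 0"
proof (rule ccontr)
  assume "b \<noteq> 0"
  \<comment> \<open>As \<open>s\<close> exceeds \<open>c\<close>, the step
    \<open>t = - b / s\<close> is short enough for the linear term to outweigh the quadratic
    one.\<close>
  define s where "s = \<bar>c\<bar> + 1"
  have s: "s > 0" "c < s" by (auto simp: s_def)
  have "2 * (- b / s) * b + (- b / s)\<^sup>2 * c = b\<^sup>2 / s * (c / s - 2)"
    using s by (simp add: field_simps power2_eq_square)
  also have "\<dots> < 0"
    using s \<open>b \<noteq> 0\<close> by (intro mult_pos_neg) (auto simp: field_simps)
  finally show False using assms[of "- b / s"] by linarith
qed

text \<open>At a maximiser \<open>p\<close> of the quadratic form \<open>Q\<close> on the sphere,
  \<open>Q p * N q - Q q\<close> is nonnegative for all \<open>q\<close> and zero at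
  \<open>q = p\<close>. Varying one coordinate of \<open>p\<close> yields one row of the eigenvalue
  equation.\<close>

lemma ex_rayleigh_maximizer:
  fixes M :: "'i \<Rightarrow> 'i \<Rightarrow> real"
  assumes "finite I" "I \<noteq> {}" and sym: "\<And>i j. i \<in> I \<Longrightarrow> j \<in> I \<Longrightarrow> M i j = M j i"
  shows "\<exists>p m. is_eigenvector I M p m \<and>
    (\<forall>q. (\<Sum>i\<in>I. \<Sum>j\<in>I. M i j * q i * q j) \<le> m * (\<Sum>i\<in>I. (q i)\<^sup>2))"
proof -
  define Q where "Q q = (\<Sum>i\<in>I. \<Sum>j\<in>I. M i j * q i * q j)" for q
  define N where "N q = (\<Sum>i\<in>I. (q i)\<^sup>2)" for q :: "'i \<Rightarrow> real"
  have "continuous_on UNIV Q" unfolding Q_def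
    by (intro continuous_intros continuous_on_product_coordinates)
  then obtain p where Np: "N p = 1"
    and pmax: "\<And>q. N q = 1 \<Longrightarrow> \<forall>i. i \<notin> I \<longrightarrow> q i = 0 \<Longrightarrow> Q q \<le> Q p"
    using ex_max_on_sphere[of I Q] assms unfolding N_def by blast
  have le: "Q q \<le> Q p * N q" for q
  proof (cases "N q = 0")
    case True
    then have "\<forall>i\<in>I. q i = 0"
      using \<open>finite I\<close> by (simp add: N_def sum_nonneg_eq_0_iff)
    then show ?thesis using True by (simp add: Q_def)
  next
    case False
    have "N q \<ge> 0" by (simp add: N_def sum_nonneg)
    with False have "N q > 0" by simp
    \<comment> \<open>The maximality of \<open>p\<close> is known only against unit vectors
      vanishing outside \<open>I\<close>, while \<open>Q\<close> and \<open>N\<close> ignore the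
      values there.\<close>
    define r where "r i = (if i \<in> I then q i / sqrt (N q) else 0)" for i
    have "N r = N q / N q"
      using \<open>N q > 0\<close> unfolding N_def[of r]
      by (simp add: r_def power_divide sum_divide_distrib[symmetric]) (simp add: N_def)
    with \<open>N q > 0\<close> have "N r = 1" by simp
    have "Q r = Q q / N q"
      unfolding Q_def r_def sum_divide_distrib using \<open>N q > 0\<close> by (intro sum.cong) auto
    with pmax[of r] \<open>N r = 1\<close> have "Q q / N q \<le> Q p" by (simp add: r_def)
    then show ?thesis using \<open>N q > 0\<close> by (simp add: field_simps)
  qed
  have "is_eigenvector I M p (Q p)"
    unfolding is_eigenvector_def
  proof (intro conjI ballI)
    show "\<exists>i\<in>I. p i \<noteq> 0"
    proof (rule ccontr)
      assume "\<not> ?thesis"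
      then have "N p = 0" by (simp add: N_def)
      with Np show False by simp
    qed
    fix k assume k: "k \<in> I"
    define h where "h i = (if i = k then 1 else 0 :: real)" for i
    have Nh: "N (\<lambda>i. p i + t * h i) = 1 + 2 * t * p k + t\<^sup>2" for t
    proof -
      have "N (\<lambda>i. p i + t * h i) = (\<Sum>i\<in>I. (p i)\<^sup>2 + (if i = k then 2 * t * p i + t\<^sup>2 else 0))"
        unfolding N_def by (rule sum.cong) (auto simp: h_def power2_sum)
      then show ?thesis using \<open>finite I\<close> k Np by (simp add: sum.distrib N_def)
    qed
    have Qh: "Q (\<lambda>i. p i + t * h i) = Q p + 2 * t * (\<Sum>j\<in>I. M k j * p j) + t\<^sup>2 * M k k" for t
    proof -
      have "Q (\<lambda>i. p i + t * h i) = (\<Sum>i\<in>I. \<Sum>j\<in>I. M i j * p i * p j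
          + (if j = k then t * (M i j * p i) else 0)
          + (if i = k then t * (M i j * p j) else 0)
          + (if i = k then if j = k then t\<^sup>2 * M i j else 0 else 0))"
        unfolding Q_def
        by (intro sum.cong) (auto simp: h_def algebra_simps power2_eq_square)
      also have "\<dots> = Q p + t * (\<Sum>i\<in>I. M i k * p i) + t * (\<Sum>j\<in>I. M k j * p j) + t\<^sup>2 * M k k"
      proof -
        have swap: "(\<Sum>i\<in>I. \<Sum>j\<in>I. (if i = k then f i j else 0)) = (\<Sum>j\<in>I. f k j)"
          for f :: "'i \<Rightarrow> 'i \<Rightarrow> real"
          by (subst sum.swap) (use \<open>finite I\<close> k in simp)
        show ?thesis
          using \<open>finite I\<close> k by (simp add: sum.distrib swap sum_distrib_left Q_def)
      qed
      also have "(\<Sum>i\<in>I. M i k * p i) = (\<Sum>j\<in>I. M k j * p j)"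
        by (rule sum.cong) (use sym k in auto)
      finally show ?thesis by (simp add: algebra_simps)
    qed
    have "Q p * p k - (\<Sum>j\<in>I. M k j * p j) = 0"
    proof (rule linear_coeff_zero)
      fix t
      \<comment> \<open>This is \<open>Q p * N q - Q q\<close> for \<open>q = p + t h\<close>; the
        constant terms cancel because \<open>N p = 1\<close>.\<close>
      show "0 \<le> 2 * t * (Q p * p k - (\<Sum>j\<in>I. M k j * p j)) + t\<^sup>2 * (Q p - M k k)"
        using le[of "\<lambda>i. p i + t * h i"] unfolding Nh Qh by (simp add: algebra_simps)
    qed
    then show "(\<Sum>j\<in>I. M k j * p j) = Q p * p k" by simp
  qed
  with le show ?thesis unfolding Q_def N_def by blast
qed

text \<open>The maximiser's eigenvalue \<open>m\<close> makes the set of eigenvalues nonempty, so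
  the maximum is attained, and \<open>m\<close> being at most this maximum carries the Rayleigh
  bound over.\<close>

lemma
  fixes M :: "'i \<Rightarrow> 'i \<Rightarrow> real"
  assumes I: "finite I" "I \<noteq> {}" and sym: "\<And>i j. i \<in> I \<Longrightarrow> j \<in> I \<Longrightarrow> M i j = M j i"
  shows ex_eigenvector_lambda_max: "\<exists>p. is_eigenvector I M p (lambda_max I M)"
    and eigenvalue_le_lambda_max: "is_eigenvector I M q l \<Longrightarrow> l \<le> lambda_max I M"
    and rayleigh_le_lambda_max:
      "(\<Sum>i\<in>I. \<Sum>j\<in>I. M i j * r i * r j) \<le> lambda_max I M * (\<Sum>i\<in>I. (r i)\<^sup>2)"
proof -
  let ?S = "{l. \<exists>w. is_eigenvector I M w l}"
  obtain p m where p: "is_eigenvector I M p m"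
    and le: "\<And>q. (\<Sum>i\<in>I. \<Sum>j\<in>I. M i j * q i * q j) \<le> m * (\<Sum>i\<in>I. (q i)\<^sup>2)"
    using ex_rayleigh_maximizer[of I M] assms by blast
  have fin: "finite ?S" by (rule finite_eigenvalues) (use assms in auto)
  have max: "lambda_max I M \<in> ?S" unfolding lambda_max_def
    using fin p by (intro Max_in) auto
  then show "\<exists>p. is_eigenvector I M p (lambda_max I M)" by simp
  show ub: "l \<le> lambda_max I M" if "is_eigenvector I M q l" for q l
    unfolding lambda_max_def using fin that by (intro Max_ge) auto
  have "m * (\<Sum>i\<in>I. (r i)\<^sup>2) \<le> lambda_max I M * (\<Sum>i\<in>I. (r i)\<^sup>2)"
    using ub[OF p] by (intro mult_right_mono) (auto simp: sum_nonneg)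
  with le[of r] show "(\<Sum>i\<in>I. \<Sum>j\<in>I. M i j * r i * r j) \<le> lambda_max I M * (\<Sum>i\<in>I. (r i)\<^sup>2)"
    by linarith
qed

text \<open>The coordinates at which the ratio of the eigenvector to \<open>z\<close> is maximal form a nonempty set;
  were the eigenvalue at least \<open>c\<close>, this set would be closed under positive entries of \<open>M\<close>.\<close>

lemma eigenvalue_less_of_subinvariant:
  fixes M :: "'i \<Rightarrow> 'i \<Rightarrow> real"
  assumes "finite I" and nonneg: "\<And>i j. i \<in> I \<Longrightarrow> j \<in> I \<Longrightarrow> i \<noteq> j \<Longrightarrow> 0 \<le> M i j"
    and z: "\<And>i. i \<in> I \<Longrightarrow> 0 < z i"
    and sub: "\<And>i. i \<in> I \<Longrightarrow> (\<Sum>j\<in>I. M i j * z j) \<le> c * z i"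
    and b: "b \<in> I" "(\<Sum>j\<in>I. M b j * z j) < c * z b"
    and irred: "\<And>J. J \<subseteq> I \<Longrightarrow> J \<noteq> {} \<Longrightarrow>
      (\<And>i j. i \<in> J \<Longrightarrow> j \<in> I \<Longrightarrow> i \<noteq> j \<Longrightarrow> 0 < M i j \<Longrightarrow> j \<in> J) \<Longrightarrow> b \<in> J"
    and ev: "is_eigenvector I M p l"
  shows "l < c"
proof (rule ccontr)
  assume "\<not> l < c"
  then have lc: "c \<le> l" by simp
  obtain i0 where i0: "i0 \<in> I" "p i0 \<noteq> 0" using ev by (auto simp: is_eigenvector_def)
  \<comment> \<open>The sign makes some coordinate positive, so that the maximal ratio
    \<open>t\<close> below is positive.\<close>
  define q where "q i = sgn (p i0) * p i" for i
  have q0: "q i0 > 0" using i0 by (simp add: q_def sgn_if)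
  have q: "(\<Sum>j\<in>I. M i j * q j) = l * q i" if "i \<in> I" for i
  proof -
    have "(\<Sum>j\<in>I. M i j * q j) = sgn (p i0) * (\<Sum>j\<in>I. M i j * p j)"
      by (simp add: q_def sum_distrib_left algebra_simps)
    then show ?thesis using ev that by (simp add: is_eigenvector_def q_def)
  qed
  define t where "t = Max ((\<lambda>i. q i / z i) ` I)"
  have le: "q i \<le> t * z i" if "i \<in> I" for i
  proof -
    have "q i / z i \<le> t" unfolding t_def using \<open>finite I\<close> that by (intro Max_ge) auto
    then show ?thesis using z[OF that] by (simp add: field_simps)
  qed
  have "t * z i0 > 0" using le[OF i0(1)] q0 by simp
  then have "t > 0" using z[OF i0(1)] by (simp add: zero_less_mult_iff)
  define J where "J = {i \<in> I. q i = t * z i}"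
  \<comment> \<open>The vector \<open>t z - q\<close> is nonnegative and vanishes at
    \<open>i\<close>, so the sign of the diagonal entry does not matter. Row \<open>i\<close> of
    \<open>M\<close> sends it to a number between 0 and \<open>(c - l) * t * z i\<close>, which is
    at most 0. So equality holds throughout, and \<open>t z - q\<close> vanishes wherever row
    \<open>i\<close> is positive.\<close>
  have eqs: "(\<Sum>j\<in>I. M i j * z j) = c * z i \<and>
      (\<forall>j\<in>I. i \<noteq> j \<longrightarrow> 0 < M i j \<longrightarrow> j \<in> J)" if "i \<in> J" for i
  proof -
    have i: "i \<in> I" "q i = t * z i" using that by (auto simp: J_def)
    have nn: "0 \<le> M i j * (t * z j - q j)" if "j \<in> I" for j
      using nonneg[of i j] le[OF that] i that by (cases "i = j") auto
    have eq: "(\<Sum>j\<in>I. M i j * (t * z j - q j)) = t * (\<Sum>j\<in>I. M i j * z j) - l * q i"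
      by (simp add: q[OF i(1), symmetric] sum_distrib_left algebra_simps sum_subtractf)
    have "l * q i = l * (t * z i)" by (simp add: i(2))
    moreover have "0 \<le> (\<Sum>j\<in>I. M i j * (t * z j - q j))"
      using nn by (simp add: sum_nonneg)
    moreover have "t * (\<Sum>j\<in>I. M i j * z j) \<le> t * (c * z i)"
      using sub[OF i(1)] \<open>t > 0\<close> by simp
    moreover have "c * (t * z i) \<le> l * (t * z i)"
      using lc \<open>t > 0\<close> z[OF i(1)] by (intro mult_right_mono) auto
    ultimately have "(\<Sum>j\<in>I. M i j * (t * z j - q j)) = 0"
      and "t * (\<Sum>j\<in>I. M i j * z j) = t * (c * z i)"
      using mult.left_commute[of t c "z i"] unfolding eq by linarith+
    moreover from this(1) have "\<forall>j\<in>I. M i j * (t * z j - q j) = 0"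
      using nn \<open>finite I\<close> by (subst (asm) sum_nonneg_eq_0_iff) auto
    ultimately show ?thesis using \<open>t > 0\<close> by (auto simp: J_def)
  qed
  have "t \<in> (\<lambda>i. q i / z i) ` I" unfolding t_def
    using \<open>finite I\<close> i0 by (intro Max_in) auto
  then have "J \<noteq> {}" using z by (force simp: J_def)
  then have "b \<in> J" using eqs by (intro irred) (auto simp: J_def)
  then show False using eqs b(2) by force
qed

section \<open>The Ricci matrix of a graph\<close>

lemma ricci_matrix_commute: "ricci_matrix E e f = ricci_matrix E f e"
  by (auto simp: ricci_matrix_def Int_commute)

lemma ricci_matrix_nonneg: "e \<noteq> f \<Longrightarrow> 0 \<le> ricci_matrix E e f"
  by (simp add: ricci_matrix_def sum_nonneg)

lemma degree_pos: "finite E \<Longrightarrow> e \<in> E \<Longrightarrow> z \<in> e \<Longrightarrow> 0 < degree E z"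
  by (auto simp: degree_def card_gt_0_iff)

lemma ricci_matrix_pos:
  assumes "finite E" "e \<in> E" "finite e" "e \<noteq> f" "z \<in> e" "z \<in> f"
  shows "0 < ricci_matrix E e f"
proof -
  have "0 < (\<Sum>z\<in>e \<inter> f. 1 / real (degree E z))"
    using assms degree_pos[of E e] by (intro sum_pos2[of _ z]) auto
  then show ?thesis using \<open>e \<noteq> f\<close> by (simp add: ricci_matrix_def)
qed

text \<open>Groups the row of \<open>e\<close> by endpoints, which is the form in which
  \<open>u\<close> and \<open>v\<close> appear. The vertex sum counts \<open>p e\<close> once with a
  plus sign although the diagonal entry is negative, hence the correction by
  \<open>2 * p e\<close>.\<close>

lemma ricci_matrix_apply:
  assumes "finite E" "e \<in> E" "finite e"
  shows "(\<Sum>f\<in>E. ricci_matrix E e f * p f) =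
    (\<Sum>z\<in>e. (vertex_sum E p z - 2 * p e) / real (degree E z))"
proof -
  let ?d = "\<lambda>z. real (degree E z)"
  have "(\<Sum>f\<in>E. ricci_matrix E e f * p f) =
      (\<Sum>f\<in>E. (\<Sum>z\<in>e. if z \<in> f then p f / ?d z else 0) -
        (if f = e then 2 * (\<Sum>z\<in>e. p e / ?d z) else 0))"
  proof (rule sum.cong[OF refl])
    fix f assume "f \<in> E"
    have "(\<Sum>z\<in>e. if z \<in> f then p f / ?d z else 0) = (\<Sum>z\<in>e \<inter> f. p f / ?d z)"
      using \<open>finite e\<close> by (simp add: sum.inter_restrict)
    then show "ricci_matrix E e f * p f = (\<Sum>z\<in>e. if z \<in> f then p f / ?d z else 0) -
        (if f = e then 2 * (\<Sum>z\<in>e. p e / ?d z) else 0)"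
      by (auto simp: ricci_matrix_def sum_distrib_right)
  qed
  also have "\<dots> = (\<Sum>f\<in>E. \<Sum>z\<in>e. if z \<in> f then p f / ?d z else 0) - 2 * (\<Sum>z\<in>e. p e / ?d z)"
    using assms by (simp add: sum_subtractf)
  also have "(\<Sum>f\<in>E. \<Sum>z\<in>e. if z \<in> f then p f / ?d z else 0) =
      (\<Sum>z\<in>e. \<Sum>f\<in>E. if z \<in> f then p f / ?d z else 0)"
    by (rule sum.swap)
  also have "\<dots> = (\<Sum>z\<in>e. vertex_sum E p z / ?d z)"
  proof (rule sum.cong[OF refl])
    fix z
    show "(\<Sum>f\<in>E. if z \<in> f then p f / ?d z else 0) = vertex_sum E p z / ?d z"
      using \<open>finite E\<close>
      unfolding vertex_sum_def sum_divide_distrib by (rule sum.inter_filter[symmetric])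
  qed
  finally show ?thesis
    by (simp add: sum_distrib_left sum_subtractf[symmetric] diff_divide_distrib)
qed

lemma ex_distinct_path:
  assumes "(x, y) \<in> R\<^sup>*"
  shows "\<exists>p. p \<noteq> [] \<and> hd p = x \<and> last p = y \<and> distinct p \<and>
    (\<forall>i. Suc i < length p \<longrightarrow> (p ! i, p ! Suc i) \<in> R)"
  using assms
proof (induction rule: rtrancl_induct)
  case base
  show ?case by (rule exI[of _ "[x]"]) simp
next
  case (step y z)
  then obtain p where p: "p \<noteq> []" "hd p = x" "last p = y" "distinct p"
    "\<And>i. Suc i < length p \<Longrightarrow> (p ! i, p ! Suc i) \<in> R" by blast
  show ?case
  proof (cases "z \<in> set p")
    case True
    then obtain k where k: "k < length p" "p ! k = z" by (auto simp: in_set_conv_nth)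
    \<comment> \<open>Returning to a vertex already on the path closes a loop, which is cut
      off.\<close>
    then have "last (take (Suc k) p) = z" by (simp add: take_Suc_conv_app_nth)
    with p k show ?thesis by (intro exI[of _ "take (Suc k) p"]) (auto simp: hd_take)
  next
    case False
    have "(((p @ [z]) ! i), ((p @ [z]) ! Suc i)) \<in> R" if "Suc i < length (p @ [z])" for i
    proof (cases "Suc i < length p")
      case True
      then show ?thesis using p(5)[of i] by (simp add: nth_append)
    next
      case False
      with that have "i = length p - 1" "Suc i = length p" using p(1) by auto
      then show ?thesis using p step.hyps by (simp add: nth_append last_conv_nth)
    qed
    with p False show ?thesis by (intro exI[of _ "p @ [z]"]) auto
  qed
qed

text \<open>A simple path from \<open>x\<close> to \<open>y\<close> avoiding the edge would be
  closed by it to a cycle. It has at least three vertices, since with two it would be the edge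
  itself.\<close>

lemma acyclic_edge_is_bridge:
  assumes acyclic: "\<nexists>p. is_cycle E p" and e: "{x, y} \<in> E" "x \<noteq> y"
  shows "(x, y) \<notin> {(a, b). {a, b} \<in> E - {{x, y}}}\<^sup>*"
proof
  assume "(x, y) \<in> {(a, b). {a, b} \<in> E - {{x, y}}}\<^sup>*"
  from ex_distinct_path[OF this]
  obtain p where p: "p \<noteq> []" "hd p = x" "last p = y" "distinct p"
    and path: "\<And>i. Suc i < length p \<Longrightarrow> (p ! i, p ! Suc i) \<in> {(a, b). {a, b} \<in> E - {{x, y}}}"
    by blast
  have adj: "{p ! i, p ! Suc i} \<in> E - {{x, y}}" if "Suc i < length p" for i
    using path[OF that] by simp
  have p0: "p ! 0 = x" and pl: "p ! (length p - 1) = y"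
    using p by (auto simp: hd_conv_nth last_conv_nth)
  have "length p \<noteq> 0" using p by simp
  moreover have "length p \<noteq> 1" using p0 pl e(2) by auto
  moreover have "length p \<noteq> 2"
  proof
    assume "length p = 2"
    with adj[of 0] p0 pl show False by simp
  qed
  ultimately have "3 \<le> length p" by linarith
  moreover have "{p ! i, p ! (Suc i mod length p)} \<in> E" if "i < length p" for i
  proof (cases "Suc i < length p")
    case True
    then show ?thesis using adj[of i] by simp
  next
    case False
    with that have "Suc i = length p" "i = length p - 1" by auto
    then show ?thesis using p0 pl e(1) by (simp add: insert_commute)
  qed
  ultimately have "is_cycle E p" using p(4) by (simp add: is_cycle_def)
  with acyclic show False by blast
qed

section \<open>Subdividing an edge of a tree\<close>

locale tree_subdivision =
  fixes V :: "'a set" and E :: "'a set set" and x y n :: 'a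
  assumes tree: "finite_tree V E" and xy_edge: "{x, y} \<in> E" and new: "n \<notin> V"
begin

definition E2 :: "'a set set" where "E2 = subdivide_edge E x y n"

text \<open>The component of \<open>x\<close> after deletion of the edge \<open>xy\<close>.\<close>

definition side :: "'a set" where
  "side = {t. (x, t) \<in> {(a, b). {a, b} \<in> E - {{x, y}}}\<^sup>*}"

text \<open>Folds the two halves of the subdivided edge back onto \<open>xy\<close>, so that vectors
  on \<open>E\<close> can be pulled back to \<open>E2\<close>.\<close>

definition parent :: "'a set \<Rightarrow> 'a set" where
  "parent f = (if n \<in> f then {x, y} else f)"

lemma edgeE:
  assumes "e \<in> E"
  obtains s t where "s \<in> V" "t \<in> V" "s \<noteq> t" "e = {s, t}"
  using assms tree by (auto simp: finite_tree_def finite_simple_graph_def)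

lemma finite_E: "finite E"
proof (rule finite_subset)
  show "E \<subseteq> Pow V" by (auto elim!: edgeE)
  show "finite (Pow V)" using tree by (simp add: finite_tree_def finite_simple_graph_def)
qed

lemma new_notin: "e \<in> E \<Longrightarrow> n \<notin> e"
  using new by (auto elim!: edgeE)

lemma distinct_vertices: "x \<noteq> y" "x \<noteq> n" "y \<noteq> n"
  using edgeE[OF xy_edge] new_notin[OF xy_edge] by (auto simp: doubleton_eq_iff)

lemma mem_E2_iff: "f \<in> E2 \<longleftrightarrow> f \<in> E \<and> f \<noteq> {x, y} \<or> f = {x, n} \<or> f = {n, y}"
  by (auto simp: E2_def subdivide_edge_def)

lemma finite_E2: "finite E2"
  using finite_E by (simp add: E2_def subdivide_edge_def)

lemma finite_edge: "f \<in> E \<Longrightarrow> finite f"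
  by (auto elim!: edgeE)

lemma finite_edge2: "f \<in> E2 \<Longrightarrow> finite f"
  by (auto simp: mem_E2_iff finite_edge)

text \<open>\<open>parent\<close> identifies the two halves of \<open>xy\<close>, but these meet
  only in \<open>n\<close>, so it is injective on the edges at any other vertex. Degrees and vertex
  sums transfer along it.\<close>

lemma bij_betw_parent:
  assumes "t \<noteq> n"
  shows "bij_betw parent {f \<in> E2. t \<in> f} {f \<in> E. t \<in> f}"
proof (rule bij_betwI')
  fix f g assume "f \<in> {f \<in> E2. t \<in> f}" "g \<in> {f \<in> E2. t \<in> f}"
  then show "parent f = parent g \<longleftrightarrow> f = g"
    using assms distinct_vertices
    by (auto simp: mem_E2_iff parent_def dest: new_notin)
next
  fix f assume "f \<in> {f \<in> E2. t \<in> f}"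
  then show "parent f \<in> {f \<in> E. t \<in> f}"
    using assms xy_edge new_notin by (auto simp: mem_E2_iff parent_def)
next
  fix e assume e: "e \<in> {f \<in> E. t \<in> f}"
  show "\<exists>f\<in>{f \<in> E2. t \<in> f}. e = parent f"
  proof (cases "e = {x, y}")
    case True
    with e have "t = x \<or> t = y" by auto
    with True show ?thesis
      by (auto simp: mem_E2_iff parent_def)
  next
    case False
    with e show ?thesis
      by (intro bexI[of _ e]) (auto simp: mem_E2_iff parent_def dest: new_notin)
  qed
qed

lemma degree_E2: "t \<noteq> n \<Longrightarrow> degree E2 t = degree E t"
  unfolding degree_def by (rule bij_betw_same_card[OF bij_betw_parent])

lemma incident_new: "{f \<in> E2. n \<in> f} = {{x, n}, {n, y}}"
  by (auto simp: mem_E2_iff dest: new_notin)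

lemma new_edges_distinct: "{x, n} \<noteq> {n, y}"
  using distinct_vertices by (auto simp: doubleton_eq_iff)

lemma degree_new: "degree E2 n = 2"
  by (simp add: degree_def incident_new new_edges_distinct)

lemma x_in_side: "x \<in> side"
  by (simp add: side_def)

text \<open>Acyclicity enters here: \<open>xy\<close> is a bridge.\<close>

lemma y_notin_side: "y \<notin> side"
  using acyclic_edge_is_bridge[of E x y] tree xy_edge distinct_vertices
  by (simp add: side_def finite_tree_def)

lemma side_closed: "s \<in> side \<Longrightarrow> {s, t} \<in> E \<Longrightarrow> {s, t} \<noteq> {x, y} \<Longrightarrow> t \<in> side"
  unfolding side_def by (auto intro: rtrancl_into_rtrancl)

lemma new_notin_side: "n \<notin> side"
proof
  assume "n \<in> side"
  then have "(x, n) \<in> {(a, b). {a, b} \<in> E - {{x, y}}}\<^sup>*" by (simp add: side_def)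
  then show False
    by (cases rule: rtranclE) (use distinct_vertices new_notin in auto)
qed

text \<open>Among the old edges only \<open>xy\<close> joins the two sides. Testing for intersection
  instead of inclusion assigns each half of \<open>xy\<close> to the side of its old endpoint, as
  \<open>n\<close> lies outside \<open>side\<close>.\<close>

lemma edge2_side:
  assumes "f \<in> E2" "t \<in> f" "t \<noteq> n"
  shows "f \<inter> side \<noteq> {} \<longleftrightarrow> t \<in> side"
proof -
  consider "f = {x, n}" | "f = {n, y}" | "f \<in> E" "f \<noteq> {x, y}"
    using assms(1) by (auto simp: mem_E2_iff)
  then show ?thesis
  proof cases
    case 3
    obtain a b where ab: "f = {a, b}" using 3(1) by (auto elim: edgeE)
    have "a \<in> side \<longleftrightarrow> b \<in> side"
      using 3 side_closed[of a b] side_closed[of b a] unfolding ab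
      by (auto simp: insert_commute)
    with ab assms(2) show ?thesis by auto
  qed (use assms x_in_side y_notin_side new_notin_side in auto)
qed

text \<open>A set of edges closed under adjacency that meets an edge at \<open>s\<close> also meets all vertices
  on a path of the original tree starting at \<open>s\<close>, in particular \<open>x\<close>.\<close>

lemma adjacency_connected:
  assumes J: "J \<subseteq> E2" "J \<noteq> {}"
    and closed: "\<And>e f t. e \<in> J \<Longrightarrow> f \<in> E2 \<Longrightarrow> t \<in> e \<Longrightarrow> t \<in> f \<Longrightarrow> f \<in> J"
  shows "{n, y} \<in> J"
proof -
  have ab: "{x, n} \<in> E2" "{n, y} \<in> E2" by (auto simp: mem_E2_iff)
  obtain e where e: "e \<in> J" using J by blast
  have "\<exists>f\<in>J. x \<in> f"
  proof (cases "n \<in> e")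
    case True
    then show ?thesis using closed[OF e ab(1), of n] by auto
  next
    case False
    with e J have "e \<in> E" by (auto simp: mem_E2_iff)
    then obtain s where s: "s \<in> e" "s \<in> V" by (auto elim: edgeE)
    have "x \<in> V" using edgeE[OF xy_edge] by (auto simp: doubleton_eq_iff)
    with s tree have "(s, x) \<in> {(a, b). {a, b} \<in> E}\<^sup>*"
      by (simp add: finite_tree_def connected_graph_def)
    then show ?thesis
    proof (induction rule: rtrancl_induct)
      case base
      show ?case using e s by blast
    next
      case (step a b)
      then obtain f where f: "f \<in> J" "a \<in> f" by blast
      show ?case
      proof (cases "{a, b} = {x, y}")
        case False
        with step have "{a, b} \<in> E2" by (simp add: mem_E2_iff)
        with closed[OF f(1) this, of a] f show ?thesis by blast
      next
        case True
        \<comment> \<open>A path step across \<open>xy\<close> is no edge of \<open>E2\<close>; it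
          is replaced by the two halves, which are adjacent at \<open>n\<close>.\<close>
        then have "a = x \<or> a = y" by (auto simp: doubleton_eq_iff)
        then have "{x, n} \<in> J \<and> {n, y} \<in> J"
          using closed[OF f(1) ab(1), of a] closed[OF f(1) ab(2), of a] f
            closed[OF _ ab(1), of "{n, y}" n] closed[OF _ ab(2), of "{x, n}" n] by auto
        with True show ?thesis by (metis insertI1 insertI2 doubleton_eq_iff)
      qed
    qed
  qed
  then have "{x, n} \<in> J" using closed[OF _ ab(1), of _ x] by auto
  then show ?thesis using closed[OF _ ab(2), of "{x, n}" n] by auto
qed

end

section \<open>The positive test vector on the subdivided tree\<close>

locale tree_subdivision_perron = tree_subdivision +
  fixes p :: "'a set \<Rightarrow> real" and l :: real
  assumes p_pos: "\<And>e. e \<in> E \<Longrightarrow> 0 < p e"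
    and p_eigen: "is_eigenvector E (ricci_matrix E) p l"
    and deg_y: "2 \<le> degree E y"
begin

definition w :: real where "w = p {x, y}"
definition u :: real where "u = (vertex_sum E p y - 2 * w) / (real (degree E y) * w)"
definition v :: real where "v = (vertex_sum E p x - 2 * w) / (real (degree E x) * w)"
text \<open>The factor \<open>A\<close> is chosen such that the eigenvalue equation holds at the new edge at \<open>x\<close>.\<close>

definition A :: real where "A = 2 * u + 1"
definition z :: "'a set \<Rightarrow> real" where
  "z f = (if f \<inter> side \<noteq> {} then 1 else A) * p (parent f)"

lemma w_pos: "0 < w"
  using p_pos[OF xy_edge] by (simp add: w_def)

lemma u_mult_w: "u * w = (vertex_sum E p y - 2 * w) / real (degree E y)"
  using w_pos by (simp add: u_def)

lemma v_mult_w: "v * w = (vertex_sum E p x - 2 * w) / real (degree E x)"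
  using w_pos by (simp add: v_def)

lemma eigen_eq:
  assumes "e \<in> E"
  shows "(\<Sum>t\<in>e. (vertex_sum E p t - 2 * p e) / real (degree E t)) = l * p e"
  using ricci_matrix_apply[OF finite_E assms finite_edge[OF assms], of p] p_eigen assms
  by (simp add: is_eigenvector_def)

lemma u_plus_v: "u + v = l"
proof -
  have "(u + v) * w = l * w"
    using eigen_eq[OF xy_edge] distinct_vertices
    by (simp add: distrib_right u_mult_w v_mult_w) (simp add: w_def)
  then show ?thesis using w_pos by simp
qed

text \<open>A second edge at \<open>y\<close> makes the vertex sum there exceed \<open>w\<close>, so
  \<open>u\<close> is greater than \<open>-1 / degree E y\<close>, which is at least
  \<open>-1/2\<close>.\<close>

lemma A_pos: "0 < A"
proof -
  let ?I = "{f \<in> E. y \<in> f}"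
  have fin: "finite ?I" using finite_E by simp
  have "?I \<noteq> {{x, y}}"
  proof
    assume "?I = {{x, y}}"
    then have "degree E y = 1" unfolding degree_def by (simp only: card.insert) simp
    with deg_y show False by simp
  qed
  then obtain f where f: "f \<in> ?I" "f \<noteq> {x, y}" using xy_edge by blast
  have "(\<Sum>f\<in>{{x, y}, f}. p f) \<le> vertex_sum E p y"
    unfolding vertex_sum_def using f xy_edge fin
    by (intro sum_mono2) (auto simp: less_imp_le p_pos)
  moreover have "0 < p f" using f p_pos by simp
  ultimately have "- w < vertex_sum E p y - 2 * w"
    using f(2) by (simp add: w_def)
  moreover have "- (real (degree E y) / 2) * w \<le> - w"
    using deg_y w_pos by simp
  ultimately have "- (real (degree E y) / 2) * w < u * w * real (degree E y)"
    unfolding u_mult_w using deg_y by simp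
  then have "- 1 / 2 * (w * real (degree E y)) < u * (w * real (degree E y))"
    by (simp add: algebra_simps)
  then have "- 1 / 2 < u"
    using w_pos deg_y by (subst (asm) mult_less_cancel_right_pos) auto
  then show ?thesis by (simp add: A_def)
qed

lemma z_pos:
  assumes "f \<in> E2"
  shows "0 < z f"
proof -
  have "parent f \<in> E" using assms xy_edge new_notin by (auto simp: mem_E2_iff parent_def)
  then show ?thesis using p_pos A_pos by (simp add: z_def)
qed

lemma z_new: "z {x, n} = w" "z {n, y} = A * w"
  using x_in_side y_notin_side new_notin_side by (auto simp: z_def parent_def w_def)

text \<open>All edges at an old vertex lie on one side and so carry the same factor.\<close>

lemma vertex_sum_z:
  assumes "t \<noteq> n"
  shows "vertex_sum E2 z t = (if t \<in> side then 1 else A) * vertex_sum E p t"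
proof -
  have "vertex_sum E2 z t = (\<Sum>f\<in>{f \<in> E2. t \<in> f}. (if t \<in> side then 1 else A) * p (parent f))"
    unfolding vertex_sum_def z_def using assms edge2_side by (intro sum.cong) auto
  also have "\<dots> = (if t \<in> side then 1 else A) * (\<Sum>f\<in>{f \<in> E2. t \<in> f}. p (parent f))"
    by (rule sum_distrib_left[symmetric])
  also have "(\<Sum>f\<in>{f \<in> E2. t \<in> f}. p (parent f)) = vertex_sum E p t"
    unfolding vertex_sum_def by (rule sum.reindex_bij_betw[OF bij_betw_parent[OF assms]])
  finally show ?thesis .
qed

lemma vertex_sum_z_new: "vertex_sum E2 z n = w + A * w"
  by (simp add: vertex_sum_def incident_new new_edges_distinct z_new)

text \<open>Away from \<open>n\<close> every row is a multiple of a row for the original tree. Only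
  the two rows at \<open>n\<close> are new, with degree 2 and vertex sum
  \<open>w + A * w\<close>.\<close>

lemma ricci_matrix_apply_z:
  assumes "f \<in> E2"
  shows "(\<Sum>g\<in>E2. ricci_matrix E2 f g * z g) =
    l * z f - (if f = {n, y} then (2 * u * v + l) * w else 0)"
proof -
  note apply_z = ricci_matrix_apply[OF finite_E2 assms finite_edge2[OF assms], of z]
  consider "f = {x, n}" | "f = {n, y}" | "f \<in> E" "f \<noteq> {x, y}"
    using assms by (auto simp: mem_E2_iff)
  then show ?thesis
  proof cases
    case 1
    have "(\<Sum>g\<in>E2. ricci_matrix E2 f g * z g) =
        (vertex_sum E2 z x - 2 * z {x, n}) / real (degree E2 x) +
        (vertex_sum E2 z n - 2 * z {x, n}) / real (degree E2 n)"
      using apply_z distinct_vertices unfolding 1 by simp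
    also have "\<dots> = v * w + (w + A * w - 2 * w) / 2"
      using x_in_side
      by (simp only: z_new vertex_sum_z[OF distinct_vertices(2)] vertex_sum_z_new
        degree_E2[OF distinct_vertices(2)] degree_new v_mult_w) simp
    also have "\<dots> = l * w" by (simp add: A_def u_plus_v[symmetric] algebra_simps)
    finally show ?thesis using 1 new_edges_distinct by (simp add: z_new)
  next
    case 2
    have "(\<Sum>g\<in>E2. ricci_matrix E2 f g * z g) =
        (vertex_sum E2 z y - 2 * z {n, y}) / real (degree E2 y) +
        (vertex_sum E2 z n - 2 * z {n, y}) / real (degree E2 n)"
      using apply_z distinct_vertices unfolding 2 by simp
    also have "\<dots> = A * (u * w) + (w + A * w - 2 * (A * w)) / 2"
      using y_notin_side
      by (simp only: z_new vertex_sum_z[OF distinct_vertices(3)] vertex_sum_z_new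
        degree_E2[OF distinct_vertices(3)] degree_new u_mult_w) (simp add: right_diff_distrib)
    \<comment> \<open>Since \<open>(1 - A) / 2 = - u\<close>, the row equals
      \<open>(A * u - u) * w\<close>; subtracting \<open>A * (u + v) * w\<close> leaves
      \<open>- (u + v + 2 * u * v) * w\<close>.\<close>
    also have "\<dots> = l * (A * w) - (2 * u * v + l) * w"
      by (simp add: A_def u_plus_v[symmetric] algebra_simps)
    finally show ?thesis using 2 by (simp add: z_new)
  next
    case 3
    define k where "k = (if f \<inter> side \<noteq> {} then 1 else A)"
    have nf: "n \<notin> f" using 3 new_notin by blast
    then have zf: "z f = k * p f" by (simp add: z_def k_def parent_def)
    have "(\<Sum>g\<in>E2. ricci_matrix E2 f g * z g) =
        (\<Sum>t\<in>f. k * ((vertex_sum E p t - 2 * p f) / real (degree E t)))"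
      unfolding apply_z
    proof (rule sum.cong[OF refl])
      fix t assume t: "t \<in> f"
      with nf have "t \<noteq> n" by blast
      then have "vertex_sum E2 z t = k * vertex_sum E p t"
        using edge2_side[OF assms t] by (simp add: vertex_sum_z k_def)
      then show "(vertex_sum E2 z t - 2 * z f) / real (degree E2 t) =
          k * ((vertex_sum E p t - 2 * p f) / real (degree E t))"
        by (simp add: zf degree_E2[OF \<open>t \<noteq> n\<close>] right_diff_distrib)
    qed
    also have "\<dots> = k * (l * p f)"
      by (simp only: sum_distrib_left[symmetric] eigen_eq[OF 3(1)])
    finally show ?thesis using nf by (auto simp: zf)
  qed
qed

lemma new_edge_mem: "{n, y} \<in> E2"
  by (simp add: mem_E2_iff)

section \<open>Comparison of the two largest eigenvalues\<close>

lemma lambda_max_E2: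
  "\<exists>q. is_eigenvector E2 (ricci_matrix E2) q (lambda_max E2 (ricci_matrix E2))"
  "is_eigenvector E2 (ricci_matrix E2) q k \<Longrightarrow> k \<le> lambda_max E2 (ricci_matrix E2)"
  "(\<Sum>f\<in>E2. \<Sum>g\<in>E2. ricci_matrix E2 f g * q f * q g)
    \<le> lambda_max E2 (ricci_matrix E2) * (\<Sum>f\<in>E2. (q f)\<^sup>2)"
  using ex_eigenvector_lambda_max[of E2 "ricci_matrix E2"]
    eigenvalue_le_lambda_max[of E2 "ricci_matrix E2"]
    rayleigh_le_lambda_max[of E2 "ricci_matrix E2"]
    finite_E2 new_edge_mem ricci_matrix_commute[of E2] by blast+

lemma lambda_max_E2_less:
  assumes sub: "\<And>f. f \<in> E2 \<Longrightarrow> (\<Sum>g\<in>E2. ricci_matrix E2 f g * z g) \<le> c * z f"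
    and strict: "(\<Sum>g\<in>E2. ricci_matrix E2 {n, y} g * z g) < c * z {n, y}"
  shows "lambda_max E2 (ricci_matrix E2) < c"
proof -
  obtain q where q: "is_eigenvector E2 (ricci_matrix E2) q (lambda_max E2 (ricci_matrix E2))"
    using lambda_max_E2(1) by blast
  show ?thesis
  proof (rule eigenvalue_less_of_subinvariant[OF finite_E2 _ z_pos sub new_edge_mem strict _ q])
    fix J assume J: "J \<subseteq> E2" "J \<noteq> {}"
      and closed: "\<And>e f. e \<in> J \<Longrightarrow> f \<in> E2 \<Longrightarrow> e \<noteq> f \<Longrightarrow> 0 < ricci_matrix E2 e f \<Longrightarrow> f \<in> J"
    \<comment> \<open>Edges sharing a vertex have a positive entry, so closure under positive
      entries is closure under adjacency; the connectedness of the tree gives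
      irreducibility.\<close>
    show "{n, y} \<in> J"
    proof (rule adjacency_connected[OF J])
      fix e f t assume eft: "e \<in> J" "f \<in> E2" "t \<in> e" "t \<in> f"
      then have "e \<in> E2" using J by blast
      then show "f \<in> J"
        using closed[OF eft(1,2)] ricci_matrix_pos[OF finite_E2 _ finite_edge2 _ eft(3,4)] eft(1)
        by blast
    qed
  qed (simp_all add: ricci_matrix_nonneg)
qed

lemma lambda_max_E2_less_if:
  assumes "0 < 2 * u * v + l"
  shows "lambda_max E2 (ricci_matrix E2) < l"
proof -
  have "0 < (2 * u * v + l) * w" using assms w_pos by simp
  then show ?thesis
    by (intro lambda_max_E2_less) (simp_all add: ricci_matrix_apply_z new_edge_mem)
qed

lemma lambda_max_E2_eq_if:
  assumes "2 * u * v + l = 0"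
  shows "lambda_max E2 (ricci_matrix E2) = l"
proof (rule antisym)
  have eq: "(\<Sum>g\<in>E2. ricci_matrix E2 f g * z g) = l * z f" if "f \<in> E2" for f
    using ricci_matrix_apply_z[OF that] assms by simp
  then have "is_eigenvector E2 (ricci_matrix E2) z l"
    unfolding is_eigenvector_def using z_pos[OF new_edge_mem] new_edge_mem
    by (auto intro!: bexI[of _ "{n, y}"])
  then show "l \<le> lambda_max E2 (ricci_matrix E2)" by (rule lambda_max_E2(2))
  \<comment> \<open>For every \<open>c > l\<close> the positive eigenvector \<open>z\<close> is a
    strict subsolution in each row, so the strict bound applies; then \<open>c\<close> tends to
    \<open>l\<close>.\<close>
  show "lambda_max E2 (ricci_matrix E2) \<le> l"
  proof (rule dense_ge)
    fix c assume "l < c"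
    then have "l * z f < c * z f" if "f \<in> E2" for f using z_pos[OF that] by simp
    then show "lambda_max E2 (ricci_matrix E2) \<le> c"
      by (intro less_imp_le lambda_max_E2_less) (simp_all add: eq less_imp_le new_edge_mem)
  qed
qed

text \<open>The defect sits in a single row, so the quadratic form at \<open>z\<close> exceeds
  \<open>l\<close> times the squared norm by exactly
  \<open>- (2 * u * v + l) * w * z {n, y}\<close>.\<close>

lemma lambda_max_E2_greater_if:
  assumes "2 * u * v + l < 0"
  shows "l < lambda_max E2 (ricci_matrix E2)"
proof -
  let ?N = "\<Sum>f\<in>E2. (z f)\<^sup>2"
  have "0 < ?N"
    using z_pos[OF new_edge_mem] new_edge_mem finite_E2
    by (intro sum_pos2[of E2 "{n, y}"]) auto
  have "(2 * u * v + l) * w * z {n, y} < 0"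
    using assms w_pos z_pos[OF new_edge_mem] by (simp add: mult_less_0_iff)
  moreover have "(\<Sum>f\<in>E2. \<Sum>g\<in>E2. ricci_matrix E2 f g * z f * z g) =
      l * ?N - (2 * u * v + l) * w * z {n, y}"
  proof -
    have "(\<Sum>f\<in>E2. \<Sum>g\<in>E2. ricci_matrix E2 f g * z f * z g) =
        (\<Sum>f\<in>E2. z f * (\<Sum>g\<in>E2. ricci_matrix E2 f g * z g))"
      by (simp add: sum_distrib_left algebra_simps)
    also have "\<dots> = (\<Sum>f\<in>E2. l * (z f)\<^sup>2 -
        (if f = {n, y} then (2 * u * v + l) * w * z {n, y} else 0))"
    proof (rule sum.cong[OF refl])
      fix f assume "f \<in> E2"
      then show "z f * (\<Sum>g\<in>E2. ricci_matrix E2 f g * z g) = l * (z f)\<^sup>2 -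
          (if f = {n, y} then (2 * u * v + l) * w * z {n, y} else 0)"
        unfolding ricci_matrix_apply_z[OF \<open>f \<in> E2\<close>]
        by (cases "f = {n, y}") (simp_all add: power2_eq_square right_diff_distrib mult_ac)
    qed
    also have "\<dots> = l * ?N - (2 * u * v + l) * w * z {n, y}"
      using finite_E2 new_edge_mem by (simp add: sum_subtractf sum_distrib_left)
    finally show ?thesis .
  qed
  ultimately have "l * ?N < lambda_max E2 (ricci_matrix E2) * ?N"
    using lambda_max_E2(3)[of z] by linarith
  with \<open>0 < ?N\<close> show ?thesis by simp
qed

end

theorem theorem1:
  fixes V :: "'a set" and E E2 :: "'a set set" and x y v1 :: 'a
    and pv :: "'a set \<Rightarrow> real" and w u v lambda1 lambda2 :: real
  assumes "finite_tree V E"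
    and "{x, y} \<in> E"
    and "degree E x \<ge> 2" and "degree E y \<ge> 2"
    and "v1 \<notin> V"
    and "E2 = subdivide_edge E x y v1"
    and "lambda1 = lambda_max E (ricci_matrix E)"
    and "lambda2 = lambda_max E2 (ricci_matrix E2)"
    and "is_perron_vector E pv"
    and "w = pv {x, y}"
    and "u = (vertex_sum E pv y - 2 * w) / (real (degree E y) * w)"
    and "v = (vertex_sum E pv x - 2 * w) / (real (degree E x) * w)"
  shows "(lambda2 < lambda1 \<longleftrightarrow> u * v > - lambda1 / 2) \<and>
         (lambda2 = lambda1 \<longleftrightarrow> u * v = - lambda1 / 2) \<and>
         (lambda2 > lambda1 \<longleftrightarrow> u * v < - lambda1 / 2)"
proof -
  interpret T: tree_subdivision_perron V E x y v1 pv lambda1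
    using assms by unfold_locales (auto simp: is_perron_vector_def)
  have eqs: "E2 = T.E2" "u = T.u" "v = T.v"
    using assms by (simp_all add: T.E2_def T.u_def T.v_def T.w_def)
  have "0 < 2 * u * v + lambda1 \<Longrightarrow> lambda2 < lambda1"
    and "2 * u * v + lambda1 = 0 \<Longrightarrow> lambda2 = lambda1"
    and "2 * u * v + lambda1 < 0 \<Longrightarrow> lambda1 < lambda2"
    unfolding \<open>lambda2 = lambda_max E2 (ricci_matrix E2)\<close> eqs
    by (fact T.lambda_max_E2_less_if T.lambda_max_E2_eq_if T.lambda_max_E2_greater_if)+
  moreover have "2 * u * v = 2 * (u * v)" by simp
  \<comment> \<open>The three cases are exhaustive and their conclusions mutually exclusive, so each
    implication is an equivalence.\<close>
  ultimately show ?thesis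
    by (cases "2 * u * v + lambda1" "0 :: real" rule: linorder_cases) auto
qed

end
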